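(* Let $K\ge2$, $0<v_1<\dots<v_K$, let $x^*$ be the aggregated market and $\beta\in[0,1]$. Then the set $\mathcal S\subset\mathbb R^2$ of achievable (consumer, producer) expected utility pairs can be represented as $$\mathcal S=\beta\,\mathbf c+(1-\beta)\,\mathcal S',$$ where $\mathbf c\in\mathbb R^2$ is the constant vector $$\mathbf c=\Big[\sum_{k=1}^K\mathbb P(\mathcal X_k^\beta)\,\mathcal U_c(v_k,x^* ),\ \sum_{k=1}^K\mathbb P(\mathcal X_k^\beta)\,\mathcal U_p(v_k,x^* )\Big]^\top,$$ $\mathbb P$ being the uniform distribution over $\mathcal X$, and $$\mathcal S'=\Big\{\Big[\sum_{k=1}^K\gamma_k\,\mathcal U_c(v_k,x_k),\ \sum_{k=1}^K\gamma_k\,\mathcal U_p(v_k,x_k)\Big]^\top:\ x_k\in\mathcal X_k^\beta,\ \gamma_k\in[0,1],\ \sum_{k=1}^K\gamma_kx_k=x^*,\ \sum_{k=1}^K\gamma_k=1\Big\}.$$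
   Context: $[K]=\{1,\dots,K\}$; $\mathcal V=\{v_1,\dots,v_K\}$; a market is a probability distribution $x$ on $\mathcal V$; $\mathcal X$ is the simplex of all markets, $\mathrm{Unif}(\mathcal X)$ the uniform distribution on it. The aggregated market is a fixed $x^*\in\mathcal X$. A segmentation is a finitely supported probability distribution $\sigma$ on $\mathcal X$ with $\sum_x\sigma(x)x=x^*$; $\Sigma$ is the set of segmentations. For a price $p\ge0$ and market $x$: $\mathcal U_p(p,x)=p\sum_k x(v_k)\mathbf 1(p\le v_k)$ (producer) and $\mathcal U_c(p,x)=\sum_k x(v_k)(v_k-p)\mathbf 1(p\le v_k)$ (consumer). Privacy mechanism with parameter $\beta\in[0,1]$: $\mathcal M_\beta(x)$ equals $x$ with probability $1-\beta$ and, with probability $\beta$, is a draw from $\mathrm{Unif}(\mathcal X)$. The producer has prior $\mathrm{Unif}(\mathcal X)$; after observing $\hat x$ the posterior is $\pi_\beta(\cdot|\hat x)=(1-\beta)\delta_{\hat x}+\beta\,\mathrm{Unif}(\mathcal X)$. Put $\mathcal U_p(p|\hat x)=\mathbb E_{x\sim\pi_\beta(\cdot|\hat x)}[\mathcal U_p(p,x)]$. A price $p$ is optimal given $\hat x$ if $\mathcal U_p(p|\hat x)\ge\mathcal U_p(p'|\hat x)$ for all $p'\ge0$ (optimal prices lie in $\mathcal V$), and $$\mathcal X_i^\beta=\{\hat x\in\mathcal X:\ \mathcal U_p(v_i|\hat x)\ge\mathcal U_p(v_j|\hat x)\ \text{for all } j\in[K]\}.$$ An optimal pricing rule is a map $\phi:\mathcal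 X\to\Delta(\mathcal V)$ such that for each $\hat x$ the support of $\phi(\hat x)$ consists only of prices optimal given $\hat x$. For $\bullet\in\{p,c\}$ let $U_\bullet^\phi(x)=\mathbb E_{\hat x\sim\mathcal M_\beta(x)}\mathbb E_{q\sim\phi(\hat x)}[\mathcal U_\bullet(q,x)]$. Then $$\mathcal S=\Big\{\big[\textstyle\sum_x\sigma(x)U_c^\phi(x),\ \sum_x\sigma(x)U_p^\phi(x)\big]^\top:\ \sigma\in\Sigma,\ \phi\text{ an optimal pricing rule}\Big\}.$$
   Formalization: In S', x_k ∈ X_k^β is required only when γ_k ≠ 0 (X_k^β may be empty, which would make S' empty while S is not), and for β = 1 the optimal price is assumed unique (with ties the probabilities P(X_k^1) sum to more than 1 and the claim fails). *)

theory Defs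
  imports "HOL-Probability.Probability"
begin

text \<open>
  The value set is \<open>{v 1, \<dots>, v K}\<close>. A market is stored by its point masses:
  \<open>x k\<close> is the probability of the value \<open>v k\<close>.
\<close>

type_synonym market = "nat \<Rightarrow> real"

definition markets :: "nat \<Rightarrow> market set" where
  "markets K = {x \<in> {1..K} \<rightarrow>\<^sub>E UNIV. (\<forall>k\<in>{1..K}. 0 \<le> x k) \<and> (\<Sum>k=1..K. x k) = 1}"


subsection \<open>The uniform distribution on the simplex\<close>

text \<open>
  The uniform distribution on \<open>markets K\<close> (normalised \<open>(K-1)\<close>-dimensional volume) is
  normalised Lebesgue measure in the coordinates \<open>x 1, \<dots>, x (K - 1)\<close>, the last coordinate
  being determined by them; the density of the surface measure with respect to these
  coordinates is constant, so the choice of the dropped coordinate does not matter.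
  The measure is completed, that is, it lives on all Lebesgue measurable sets of markets. For
  that reason no measurability requirement is imposed on pricing rules below.
\<close>

definition solid_simplex :: "nat \<Rightarrow> (nat \<Rightarrow> real) set" where
  "solid_simplex K =
     {y \<in> {1..<K} \<rightarrow>\<^sub>E UNIV. (\<forall>k\<in>{1..<K}. 0 \<le> y k) \<and> (\<Sum>k\<in>{1..<K}. y k) \<le> 1}"

definition unif_solid_simplex :: "nat \<Rightarrow> (nat \<Rightarrow> real) measure" where
  "unif_solid_simplex K =
     uniform_measure (restrict_space (\<Pi>\<^sub>M k\<in>{1..<K}. lborel) (solid_simplex K)) (solid_simplex K)"

definition unif_markets :: "nat \<Rightarrow> market measure" where
  "unif_markets K = completion
     (distr (unif_solid_simplex K) (restrict_space (\<Pi>\<^sub>M k\<in>{1..K}. borel) (markets K))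
        (\<lambda>y. y(K := 1 - (\<Sum>k\<in>{1..<K}. y k))))"


subsection \<open>Utilities and optimal prices\<close>

definition producer_utility :: "nat \<Rightarrow> (nat \<Rightarrow> real) \<Rightarrow> real \<Rightarrow> market \<Rightarrow> real" where
  "producer_utility K v p x = p * (\<Sum>k=1..K. x k * of_bool (p \<le> v k))"

definition consumer_utility :: "nat \<Rightarrow> (nat \<Rightarrow> real) \<Rightarrow> real \<Rightarrow> market \<Rightarrow> real" where
  "consumer_utility K v p x = (\<Sum>k=1..K. x k * (v k - p) * of_bool (p \<le> v k))"

definition mechanism :: "nat \<Rightarrow> real \<Rightarrow> market \<Rightarrow> market measure" where
  "mechanism K \<beta> x =
     measure_pmf (bernoulli_pmf \<beta>) \<bind>
       (\<lambda>b. if b then unif_markets K else return (unif_markets K) x)"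

text \<open>
  For the uniform prior, the posterior given the observation \<open>xh\<close> is the mixture
  \<open>(1 - \<beta>) \<delta>\<^sub>x\<^sub>h + \<beta> Unif\<close>.
\<close>

definition posterior :: "nat \<Rightarrow> real \<Rightarrow> market \<Rightarrow> market measure" where
  "posterior K \<beta> xh =
     measure_pmf (bernoulli_pmf \<beta>) \<bind>
       (\<lambda>b. if b then unif_markets K else return (unif_markets K) xh)"

definition posterior_utility :: "nat \<Rightarrow> (nat \<Rightarrow> real) \<Rightarrow> real \<Rightarrow> real \<Rightarrow> market \<Rightarrow> real" where
  "posterior_utility K v \<beta> p xh = (\<integral>x. producer_utility K v p x \<partial>posterior K \<beta> xh)"

definition optimal_price :: "nat \<Rightarrow> (nat \<Rightarrow> real) \<Rightarrow> real \<Rightarrow> market \<Rightarrow> real \<Rightarrow> bool" where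
  "optimal_price K v \<beta> xh p \<longleftrightarrow>
     0 \<le> p \<and> (\<forall>p'\<ge>0. posterior_utility K v \<beta> p' xh \<le> posterior_utility K v \<beta> p xh)"

text \<open>
  For \<open>\<beta> < 1\<close> the regions overlap only in null sets. For \<open>\<beta> = 1\<close> the posterior ignores the
  observation, each region is empty or all of \<open>markets K\<close>, and two optimal prices have the same
  region of measure 1; uniqueness of the optimal price has to be assumed in that case.
\<close>

definition optimal_region :: "nat \<Rightarrow> (nat \<Rightarrow> real) \<Rightarrow> real \<Rightarrow> nat \<Rightarrow> market set" where
  "optimal_region K v \<beta> i =
     {xh \<in> markets K. \<forall>j\<in>{1..K}. posterior_utility K v \<beta> (v j) xh \<le> posterior_utility K v \<beta> (v i) xh}"

definition optimal_pricing_rule ::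
    "nat \<Rightarrow> (nat \<Rightarrow> real) \<Rightarrow> real \<Rightarrow> (market \<Rightarrow> real pmf) \<Rightarrow> bool" where
  "optimal_pricing_rule K v \<beta> \<phi> \<longleftrightarrow>
     (\<forall>xh\<in>markets K. set_pmf (\<phi> xh) \<subseteq> v ` {1..K} \<and> (\<forall>p\<in>set_pmf (\<phi> xh). optimal_price K v \<beta> xh p))"


subsection \<open>Segmentations and achievable utilities\<close>

definition segmentation :: "nat \<Rightarrow> market \<Rightarrow> market pmf \<Rightarrow> bool" where
  "segmentation K xs \<sigma> \<longleftrightarrow>
     finite (set_pmf \<sigma>) \<and> set_pmf \<sigma> \<subseteq> markets K \<and>
     (\<forall>k\<in>{1..K}. (\<Sum>x\<in>set_pmf \<sigma>. pmf \<sigma> x * x k) = xs k)"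

text \<open>The argument \<open>u\<close> is the consumer or the producer utility as a function of price and market.\<close>

definition expected_utility ::
    "nat \<Rightarrow> real \<Rightarrow> (real \<Rightarrow> market \<Rightarrow> real) \<Rightarrow> (market \<Rightarrow> real pmf) \<Rightarrow> market \<Rightarrow> real" where
  "expected_utility K \<beta> u \<phi> x =
     (\<integral>xh. measure_pmf.expectation (\<phi> xh) (\<lambda>q. u q x) \<partial>mechanism K \<beta> x)"

definition achievable :: "nat \<Rightarrow> (nat \<Rightarrow> real) \<Rightarrow> real \<Rightarrow> market \<Rightarrow> (real \<times> real) set" where
  "achievable K v \<beta> xs =
     {(\<Sum>x\<in>set_pmf \<sigma>. pmf \<sigma> x * expected_utility K \<beta> (consumer_utility K v) \<phi> x,
       \<Sum>x\<in>set_pmf \<sigma>. pmf \<sigma> x * expected_utility K \<beta> (producer_utility K v) \<phi> x) | \<sigma> \<phi>.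
      segmentation K xs \<sigma> \<and> optimal_pricing_rule K v \<beta> \<phi>}"

definition noise_utility :: "nat \<Rightarrow> (nat \<Rightarrow> real) \<Rightarrow> real \<Rightarrow> market \<Rightarrow> real \<times> real" where
  "noise_utility K v \<beta> xs =
     (\<Sum>k=1..K. measure (unif_markets K) (optimal_region K v \<beta> k) * consumer_utility K v (v k) xs,
      \<Sum>k=1..K. measure (unif_markets K) (optimal_region K v \<beta> k) * producer_utility K v (v k) xs)"

text \<open>
  Membership \<open>y k \<in> optimal_region K v \<beta> k\<close> is demanded only for those \<open>k\<close> that carry weight.
  A price \<open>v k\<close> may be optimal for no observation at all, in which case \<open>optimal_region K v \<beta> k\<close>
  is empty and the \<open>k\<close>-th term has to be absent, that is, \<open>\<gamma> k = 0\<close>. If the region is nonempty,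
  then \<open>y k\<close> can be chosen in it, and for \<open>\<gamma> k = 0\<close> the choice is irrelevant.
\<close>

definition truthful_achievable ::
    "nat \<Rightarrow> (nat \<Rightarrow> real) \<Rightarrow> real \<Rightarrow> market \<Rightarrow> (real \<times> real) set" where
  "truthful_achievable K v \<beta> xs =
     {(\<Sum>k=1..K. \<gamma> k * consumer_utility K v (v k) (y k),
       \<Sum>k=1..K. \<gamma> k * producer_utility K v (v k) (y k)) | \<gamma> y.
      (\<forall>k\<in>{1..K}. \<gamma> k \<in> {0..1} \<and> (\<gamma> k \<noteq> 0 \<longrightarrow> y k \<in> optimal_region K v \<beta> k)) \<and>
      (\<forall>j\<in>{1..K}. (\<Sum>k=1..K. \<gamma> k * y k j) = xs j) \<and>
      (\<Sum>k=1..K. \<gamma> k) = 1}"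

end

theory Submission
  imports Defs
begin

text \<open>
  The posterior utility of a price is affine in the observation, so each optimality region is
  convex, and (for \<open>\<beta> < 1\<close>) two regions meet only in a hyperplane section of the simplex, a
  null set. An observation that is pure noise therefore leads to the price \<open>v k\<close> with probability
  \<open>P (region k)\<close>, whatever the pricing rule; by linearity of the utilities in the market this
  yields the constant vector. When the observation is truthful, merging the segments that
  receive the same price (with convexity of the regions) gives a point of the truthful set, and
  conversely the weights \<open>\<gamma>\<close> are split into a segmentation and conditional price laws.
\<close>

declare One_nat_def [simp del]

section \<open>Null hyperplanes and the volume of the solid simplex\<close>

text \<open>Fubini in the coordinate \<open>i\<close>: once the other coordinates are fixed,
  \<open>a i \<noteq> 0\<close> leaves a single value of the \<open>i\<close>-th one on the
  hyperplane, and a point has Lebesgue measure zero.\<close>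

lemma hyperplane_null_PiM_lborel:
  fixes a :: "'i \<Rightarrow> real"
  assumes "finite I" "i \<in> I" "a i \<noteq> 0"
  shows "AE y in (\<Pi>\<^sub>M k\<in>I. lborel). (\<Sum>k\<in>I. a k * y k) \<noteq> d"
proof -
  interpret product_sigma_finite "\<lambda>_::'i. lborel :: real measure"
    by (simp add: product_sigma_finite_def sigma_finite_lborel)
  define J where "J = I - {i}"
  have J: "finite J" "i \<notin> J" "I = insert i J"
    using assms by (auto simp: J_def)
  define N where "N = {y \<in> space (\<Pi>\<^sub>M k\<in>I. (lborel::real measure)). (\<Sum>k\<in>I. a k * y k) = d}"
  have [measurable]: "N \<in> sets (\<Pi>\<^sub>M k\<in>I. lborel)"
    unfolding N_def by measurable
  have "emeasure (\<Pi>\<^sub>M k\<in>I. lborel) N = (\<integral>\<^sup>+y. indicator N y \<partial>(\<Pi>\<^sub>M k\<in>I. lborel))"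
    by simp
  also have "\<dots> = (\<integral>\<^sup>+x. \<integral>\<^sup>+t. indicator N (x(i := t)) \<partial>lborel \<partial>(\<Pi>\<^sub>M k\<in>J. lborel))"
    using product_nn_integral_insert[OF J(1,2), of "indicator N"] by (simp flip: J(3))
  also have "\<dots> = (\<integral>\<^sup>+x. 0 \<partial>(\<Pi>\<^sub>M k\<in>J. (lborel::real measure)))"
  proof (intro nn_integral_cong)
    fix x assume "x \<in> space (\<Pi>\<^sub>M k\<in>J. (lborel::real measure))"
    have "indicator N (x(i := t)) \<le> (indicator {(d - (\<Sum>k\<in>J. a k * x k)) / a i} t :: ennreal)" for t
    proof -
      have "(\<Sum>k\<in>J. a k * (x(i := t)) k) = (\<Sum>k\<in>J. a k * x k)"
        using J(2) by (intro sum.cong) auto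
      then have "(\<Sum>k\<in>I. a k * (x(i := t)) k) = a i * t + (\<Sum>k\<in>J. a k * x k)"
        using J by simp
      then show ?thesis
        using assms(3) by (auto simp: N_def indicator_def field_simps)
    qed
    then have "(\<integral>\<^sup>+t. indicator N (x(i := t)) \<partial>lborel)
        \<le> (\<integral>\<^sup>+t. indicator {(d - (\<Sum>k\<in>J. a k * x k)) / a i} t \<partial>lborel)"
      by (intro nn_integral_mono) auto
    then show "(\<integral>\<^sup>+t. indicator N (x(i := t)) \<partial>lborel) = 0"
      by simp
  qed
  finally have "N \<in> null_sets (\<Pi>\<^sub>M k\<in>I. lborel)"
    by (intro null_setsI) simp_all
  then show ?thesis
    by (rule AE_I') (auto simp: N_def)
qed

lemma solid_simplex_sets [measurable]: "solid_simplex K \<in> sets (\<Pi>\<^sub>M k\<in>{1..<K}. lborel)"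
proof -
  have "solid_simplex K = {y \<in> space (\<Pi>\<^sub>M k\<in>{1..<K}. (lborel::real measure)).
      (\<forall>k\<in>{1..<K}. 0 \<le> y k) \<and> (\<Sum>k\<in>{1..<K}. y k) \<le> 1}"
    by (auto simp: solid_simplex_def space_PiM)
  also have "\<dots> \<in> sets (\<Pi>\<^sub>M k\<in>{1..<K}. lborel)"
    by measurable
  finally show ?thesis .
qed

lemma emeasure_PiM_lborel_box:
  assumes "finite I" "0 \<le> b"
  shows "emeasure (\<Pi>\<^sub>M k\<in>I. lborel) (\<Pi>\<^sub>E k\<in>I. {0..b::real}) = ennreal (b ^ card I)"
proof -
  interpret product_sigma_finite "\<lambda>_. lborel :: real measure"
    by (simp add: product_sigma_finite_def sigma_finite_lborel)
  show ?thesis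
    using assms by (subst emeasure_PiM) (simp_all add: ennreal_power)
qed

text \<open>The simplex is squeezed between two cubes with a corner at the origin, one of positive
  volume inside and the unit cube outside. Both bounds are what makes the normalised measure a
  probability measure.\<close>

lemma emeasure_solid_simplex:
  "emeasure (\<Pi>\<^sub>M k\<in>{1..<K}. lborel) (solid_simplex K) \<noteq> 0"
  "emeasure (\<Pi>\<^sub>M k\<in>{1..<K}. lborel) (solid_simplex K) \<noteq> \<infinity>"
proof -
  let ?M = "\<Pi>\<^sub>M k\<in>{1..<K}. (lborel::real measure)"
  \<comment> \<open>With this side length the \<open>K - 1\<close> coordinates sum to at most
    \<open>(K - 1) / (K + 1)\<close>, which is below 1; the summand 1 in the denominator keeps
    \<open>b\<close> positive for \<open>K = 0\<close> as well.\<close>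
  define b where "b = 1 / (real K + 1)"
  have b: "b > 0" "real (K - 1) * b \<le> 1"
    by (auto simp: b_def field_simps)
  have [measurable]: "(\<Pi>\<^sub>E k\<in>{1..<K}. {0..c::real}) \<in> sets ?M" for c
    by (intro sets_PiM_I_finite) auto
  have "(\<Pi>\<^sub>E k\<in>{1..<K}. {0..b}) \<subseteq> solid_simplex K"
  proof
    fix y assume y: "y \<in> (\<Pi>\<^sub>E k\<in>{1..<K}. {0..b})"
    then have "(\<Sum>k\<in>{1..<K}. y k) \<le> real (card {1..<K}) * b"
      by (intro sum_bounded_above) (auto simp: PiE_iff)
    with y b(2) show "y \<in> solid_simplex K"
      by (auto simp: solid_simplex_def PiE_iff)
  qed
  then have "emeasure ?M (\<Pi>\<^sub>E k\<in>{1..<K}. {0..b}) \<le> emeasure ?M (solid_simplex K)"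
    by (intro emeasure_mono) auto
  moreover have "emeasure ?M (\<Pi>\<^sub>E k\<in>{1..<K}. {0..b}) > 0"
    using b(1) by (subst emeasure_PiM_lborel_box) auto
  ultimately show "emeasure ?M (solid_simplex K) \<noteq> 0"
    by auto
  have "solid_simplex K \<subseteq> (\<Pi>\<^sub>E k\<in>{1..<K}. {0..1})"
  proof
    fix y assume y: "y \<in> solid_simplex K"
    have "y k \<le> 1" if "k \<in> {1..<K}" for k
    proof -
      have "y k \<le> (\<Sum>k\<in>{1..<K}. y k)"
        using y that by (intro member_le_sum) (auto simp: solid_simplex_def)
      with y show ?thesis by (auto simp: solid_simplex_def)
    qed
    with y show "y \<in> (\<Pi>\<^sub>E k\<in>{1..<K}. {0..1})"
      by (auto simp: solid_simplex_def PiE_iff)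
  qed
  then have "emeasure ?M (solid_simplex K) \<le> emeasure ?M (\<Pi>\<^sub>E k\<in>{1..<K}. {0..1})"
    by (intro emeasure_mono) auto
  also have "\<dots> < \<infinity>"
    by (subst emeasure_PiM_lborel_box) auto
  finally show "emeasure ?M (solid_simplex K) \<noteq> \<infinity>"
    by simp
qed

lemma space_unif_solid_simplex: "space (unif_solid_simplex K) = solid_simplex K"
  using sets.sets_into_space[OF solid_simplex_sets[of K]]
  by (auto simp: unif_solid_simplex_def space_restrict_space)

lemma sets_unif_solid_simplex:
  "sets (unif_solid_simplex K) = sets (restrict_space (\<Pi>\<^sub>M k\<in>{1..<K}. lborel) (solid_simplex K))"
  by (simp add: unif_solid_simplex_def)

lemma prob_space_unif_solid_simplex: "prob_space (unif_solid_simplex K)"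
  unfolding unif_solid_simplex_def
  using emeasure_solid_simplex[of K]
  by (intro prob_space_uniform_measure) (simp_all add: emeasure_restrict_space)

lemma AE_unif_solid_simplex:
  assumes "AE y in (\<Pi>\<^sub>M k\<in>{1..<K}. lborel). P y"
  shows "AE y in unif_solid_simplex K. P y"
proof -
  have "AE y in restrict_space (\<Pi>\<^sub>M k\<in>{1..<K}. lborel) (solid_simplex K). P y"
    using assms by (subst AE_restrict_space_iff) auto
  then show ?thesis
    unfolding unif_solid_simplex_def
    by (intro AE_uniform_measureI) (auto simp: sets_restrict_space_iff)
qed

section \<open>The uniform law on markets in coordinates\<close>

text \<open>This is the map along which \<open>unif_markets\<close> pushes the uniform law on the
  solid simplex forward.\<close>

definition complete_market :: "nat \<Rightarrow> (nat \<Rightarrow> real) \<Rightarrow> market" where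
  "complete_market K y = y(K := 1 - (\<Sum>k\<in>{1..<K}. y k))"

text \<open>The completion in \<open>unif_markets\<close> is taken after the push-forward, so
  measurability of the coordinate map is stated with this Borel space as target.\<close>

definition borel_markets :: "nat \<Rightarrow> market measure" where
  "borel_markets K = restrict_space (\<Pi>\<^sub>M k\<in>{1..K}. borel) (markets K)"

lemma space_borel_markets [simp]: "space (borel_markets K) = markets K"
  by (auto simp: borel_markets_def space_restrict_space space_PiM markets_def)

lemma sum_complete_market:
  assumes "1 \<le> K"
  shows "(\<Sum>k=1..K. a k * complete_market K y k)
    = a K + (\<Sum>k\<in>{1..<K}. (a k - a K) * y k)"
proof -
  have "{1..K} = insert K {1..<K}"
    using assms by auto
  moreover have "(\<Sum>k\<in>{1..<K}. a k * complete_market K y k) = (\<Sum>k\<in>{1..<K}. a k * y k)"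
    by (intro sum.cong) (auto simp: complete_market_def)
  ultimately show ?thesis
    by (simp add: complete_market_def algebra_simps sum_subtractf sum_distrib_left)
qed

lemma complete_market_in_markets:
  assumes "1 \<le> K" "y \<in> solid_simplex K"
  shows "complete_market K y \<in> markets K"
proof -
  have "(\<Sum>k=1..K. complete_market K y k) = 1"
    using sum_complete_market[of K "\<lambda>_. 1" y] assms(1) by simp
  with assms show ?thesis
    by (force simp: markets_def solid_simplex_def complete_market_def PiE_iff extensional_def)
qed

lemma complete_market_measurable [measurable]:
  assumes "1 \<le> K"
  shows "complete_market K \<in> measurable (unif_solid_simplex K) (borel_markets K)"
  unfolding borel_markets_def
proof (rule measurable_restrict_space2)
  show "complete_market K \<in> space (unif_solid_simplex K) \<rightarrow> markets K"
    using assms by (auto simp: space_unif_solid_simplex complete_market_in_markets)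
  have [simp]: "insert K {1..<K} = {1..K}"
    using assms by auto
  have "complete_market K \<in> measurable (\<Pi>\<^sub>M k\<in>{1..<K}. lborel) (\<Pi>\<^sub>M k\<in>insert K {1..<K}. borel)"
    unfolding complete_market_def
    by (rule measurable_fun_upd[where J = "{1..<K}"]) (auto intro!: measurable_PiM_single' simp: PiE_iff space_PiM)
  then show "complete_market K \<in> measurable (unif_solid_simplex K) (\<Pi>\<^sub>M k\<in>{1..K}. borel)"
    by (simp add: measurable_restrict_space1 measurable_cong_sets[OF sets_unif_solid_simplex refl])
qed

lemma unif_markets_eq:
  "unif_markets K = completion (distr (unif_solid_simplex K) (borel_markets K) (complete_market K))"
  by (simp add: unif_markets_def borel_markets_def complete_market_def[abs_def])

lemma space_unif_markets [simp]: "space (unif_markets K) = markets K"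
  by (simp add: unif_markets_eq)

lemma prob_space_unif_markets:
  assumes "1 \<le> K"
  shows "prob_space (unif_markets K)"
  unfolding unif_markets_eq
  by (intro prob_space.prob_space_completion prob_space.prob_space_distr
      prob_space_unif_solid_simplex complete_market_measurable assms)

lemma market_component_measurable [measurable]:
  "(\<lambda>x. x k) \<in> borel_measurable (unif_markets K)"
proof (cases "k \<in> {1..K}")
  case True
  then have "(\<lambda>x. x k) \<in> borel_measurable (\<Pi>\<^sub>M k\<in>{1..K}. borel :: real measure)"
    by measurable
  then show ?thesis
    unfolding unif_markets_eq borel_markets_def
    by (intro measurable_completion) (simp add: measurable_restrict_space1)
next
  case False
  \<comment> \<open>Markets are extensional, so a coordinate outside the index range is a constant
    function.\<close>
  then have "x k = undefined" if "x \<in> markets K" for x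
    using that by (auto simp: markets_def PiE_iff extensional_def)
  then show ?thesis
    by (subst measurable_cong[where g = "\<lambda>_. undefined"]) auto
qed

text \<open>Since the coordinates of a market sum to 1, a linear form with equal coefficients is
  constant on the simplex; the form must therefore have a coefficient different from
  \<open>a K\<close>. Eliminating the last coordinate leaves the coefficient
  \<open>a i - a K \<noteq> 0\<close> in front of the \<open>i\<close>-th free coordinate, and the
  null hyperplane in Lebesgue measure carries over.\<close>

lemma AE_unif_markets_hyperplane:
  assumes "1 \<le> K" "i \<in> {1..K}" "a i \<noteq> a K"
  shows "AE x in unif_markets K. (\<Sum>k=1..K. a k * x k) \<noteq> d"
proof -
  have "i \<in> {1..<K}"
    using assms by (cases "i = K") auto
  then have "AE y in (\<Pi>\<^sub>M k\<in>{1..<K}. lborel). (\<Sum>k\<in>{1..<K}. (a k - a K) * y k) \<noteq> d - a K"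
    using assms(3) by (intro hyperplane_null_PiM_lborel) auto
  then have "AE y in unif_solid_simplex K. (\<Sum>k\<in>{1..<K}. (a k - a K) * y k) \<noteq> d - a K"
    by (rule AE_unif_solid_simplex)
  then have *: "AE y in unif_solid_simplex K. (\<Sum>k=1..K. a k * complete_market K y k) \<noteq> d"
    by eventually_elim (use sum_complete_market[OF assms(1), of a] in \<open>auto simp: algebra_simps\<close>)
  have [measurable]: "(\<lambda>x. \<Sum>k=1..K. a k * x k) \<in> borel_measurable (borel_markets K)"
    unfolding borel_markets_def by (intro measurable_restrict_space1) measurable
  have "{x \<in> space (borel_markets K). (\<Sum>k=1..K. a k * x k) \<noteq> d} \<in> sets (borel_markets K)"
    by measurable
  then have "AE x in distr (unif_solid_simplex K) (borel_markets K) (complete_market K). (\<Sum>k=1..K. a k * x k) \<noteq> d"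
    using * assms(1) by (subst AE_distr_iff) auto
  then show ?thesis
    unfolding unif_markets_eq by (rule AE_completion)
qed

section \<open>Completeness, mixtures of markets, linear utilities\<close>

text \<open>The preimages under \<open>f\<close> and \<open>g\<close> differ by a subset of a null
  set, which is measurable by completeness. This lets arbitrary pricing rules be integrated over the
  noise.\<close>

lemma (in complete_measure) borel_measurable_AE_eq:
  assumes "g \<in> borel_measurable M" "AE x in M. f x = g x"
  shows "f \<in> borel_measurable M"
proof (rule measurableI)
  fix A :: "'b set" assume "A \<in> sets borel"
  then have g: "g -` A \<inter> space M \<in> sets M"
    using assms(1) by (rule measurable_sets[rotated])
  have "AE x in M. x \<in> g -` A \<inter> space M \<longleftrightarrow> x \<in> f -` A \<inter> space M"
    using assms(2) by eventually_elim auto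
  then show "f -` A \<inter> space M \<in> sets M"
    by (rule in_sets_AE[OF _ g]) simp
qed auto

text \<open>Each coordinate of a market lies in the unit interval. The bound is the same for all
  markets, so it serves as a dominating constant for integrals over them.\<close>

lemma market_sum_bound:
  assumes "x \<in> markets K"
  shows "\<bar>\<Sum>k=1..K. x k * c k\<bar> \<le> (\<Sum>k=1..K. \<bar>c k\<bar>)"
proof -
  have "\<bar>x k * c k\<bar> \<le> \<bar>c k\<bar>" if "k \<in> {1..K}" for k
  proof -
    have "x k \<le> (\<Sum>k=1..K. x k)"
      using assms that by (intro member_le_sum) (auto simp: markets_def)
    then have "0 \<le> x k" "x k \<le> 1"
      using assms that by (auto simp: markets_def)
    then show ?thesis
      by (simp add: abs_mult mult_left_le_one_le)
  qed
  then show ?thesis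
    by (intro order.trans[OF sum_abs] sum_mono) auto
qed

text \<open>The restriction to \<open>{1..K}\<close> keeps the mixture extensional, as membership in
  \<open>markets\<close> demands.\<close>

lemma markets_convex_combination:
  assumes "finite A" "A \<subseteq> markets K" "\<And>x. x \<in> A \<Longrightarrow> 0 \<le> w x" "(\<Sum>x\<in>A. w x) = 1"
  shows "(\<lambda>k\<in>{1..K}. \<Sum>x\<in>A. w x * x k) \<in> markets K"
proof -
  have "(\<Sum>k=1..K. \<Sum>x\<in>A. w x * x k) = (\<Sum>x\<in>A. w x * (\<Sum>k=1..K. x k))"
    by (subst sum.swap) (simp add: sum_distrib_left)
  also have "\<dots> = (\<Sum>x\<in>A. w x * 1)"
    using assms(2) by (intro sum.cong) (auto simp: markets_def)
  finally have "(\<Sum>k=1..K. \<Sum>x\<in>A. w x * x k) = 1"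
    using assms(4) by simp
  moreover have "0 \<le> (\<Sum>x\<in>A. w x * x k)" if "k \<in> {1..K}" for k
    using assms(2,3) that by (intro sum_nonneg mult_nonneg_nonneg) (auto simp: markets_def)
  ultimately show ?thesis
    by (simp add: markets_def)
qed

lemma sum_convex_combination:
  fixes c :: "nat \<Rightarrow> real"
  shows "(\<Sum>k=1..K. (\<lambda>k\<in>{1..K}. \<Sum>x\<in>A. w x * x k) k * c k) = (\<Sum>x\<in>A. w x * (\<Sum>k=1..K. x k * c k))"
proof -
  have "(\<Sum>k=1..K. (\<lambda>k\<in>{1..K}. \<Sum>x\<in>A. w x * x k) k * c k) = (\<Sum>k=1..K. \<Sum>x\<in>A. w x * (x k * c k))"
    by (intro sum.cong) (auto simp: sum_distrib_right mult.assoc)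
  also have "\<dots> = (\<Sum>x\<in>A. w x * (\<Sum>k=1..K. x k * c k))"
    by (subst sum.swap) (simp add: sum_distrib_left)
  finally show ?thesis .
qed

text \<open>The coefficients do not involve the market. Later lemmas are stated for any utility of
  this form, so that consumer and producer are treated at once.\<close>

lemma producer_utility_linear:
  "producer_utility K v p x = (\<Sum>k=1..K. x k * (p * of_bool (p \<le> v k)))"
  unfolding producer_utility_def sum_distrib_left by (intro sum.cong) simp_all

lemma consumer_utility_linear:
  "consumer_utility K v p x = (\<Sum>k=1..K. x k * ((v k - p) * of_bool (p \<le> v k)))"
  by (simp add: consumer_utility_def mult.assoc)

lemma pmf_of_weights:
  fixes w :: "'a \<Rightarrow> real"
  assumes "finite A" "\<And>x. x \<in> A \<Longrightarrow> 0 \<le> w x" "(\<Sum>x\<in>A. w x) = 1"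
  obtains p where "set_pmf p \<subseteq> A" "\<And>x. x \<in> A \<Longrightarrow> pmf p x = w x"
proof -
  define f where "f x = (if x \<in> A then w x else 0)" for x
  have nonneg: "0 \<le> f x" for x
    using assms(2) by (simp add: f_def)
  have "(\<integral>\<^sup>+x. ennreal (f x) \<partial>count_space UNIV) = (\<Sum>x\<in>A. ennreal (f x))"
    using assms(1) by (intro nn_integral_count_space') (auto simp: f_def)
  also have "\<dots> = ennreal (\<Sum>x\<in>A. w x)"
    using assms(2) by (subst sum_ennreal[symmetric]) (auto simp: f_def intro!: sum.cong)
  finally have "(\<integral>\<^sup>+x. ennreal (f x) \<partial>count_space UNIV) = 1"
    using assms(3) by simp
  then have "pmf (embed_pmf f) = f" "set_pmf (embed_pmf f) = {x. f x \<noteq> 0}"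
    using nonneg by (auto simp: pmf_embed_pmf set_embed_pmf)
  then show ?thesis
    by (intro that[of "embed_pmf f"]) (auto simp: f_def split: if_splits)
qed

section \<open>The mechanism and the posterior utility\<close>

locale privacy_model =
  fixes K :: nat and v :: "nat \<Rightarrow> real" and \<beta> :: real
  assumes K_ge_1: "1 \<le> K"
    and v_1_pos: "0 < v 1"
    and v_mono: "strict_mono_on {1..K} v"
    and beta_range: "0 \<le> \<beta>" "\<beta> \<le> 1"
    and unique_optimal_price: "\<beta> = 1 \<Longrightarrow> xh \<in> markets K \<Longrightarrow> \<exists>!p. optimal_price K v \<beta> xh p"
begin

abbreviation "region \<equiv> optimal_region K v \<beta>"

sublocale unif: prob_space "unif_markets K"
  by (rule prob_space_unif_markets[OF K_ge_1])

lemma v_less_iff: "i \<in> {1..K} \<Longrightarrow> j \<in> {1..K} \<Longrightarrow> v i < v j \<longleftrightarrow> i < j"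
  using v_mono by (rule strict_mono_on_less)

lemma v_le_iff: "i \<in> {1..K} \<Longrightarrow> j \<in> {1..K} \<Longrightarrow> v i \<le> v j \<longleftrightarrow> i \<le> j"
  using v_less_iff[of j i] by (auto simp: not_less[symmetric])

lemma v_inj: "inj_on v {1..K}"
  using v_mono by (rule strict_mono_on_imp_inj_on)

lemma v_pos: "k \<in> {1..K} \<Longrightarrow> 0 < v k"
  using v_1_pos v_le_iff[of 1 k] by auto

text \<open>Conditioning on the Bernoulli draw splits the integral into its noisy and its truthful
  part. The bound \<open>B\<close> is there because the integral over a monadic bind is computed for
  bounded integrands.\<close>

lemma integral_mechanism:
  assumes f: "f \<in> borel_measurable (unif_markets K)" and x: "x \<in> markets K"
    and B: "\<And>z. z \<in> markets K \<Longrightarrow> \<bar>f z\<bar> \<le> (B::real)"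
  shows "(\<integral>z. f z \<partial>mechanism K \<beta> x) = \<beta> * (\<integral>z. f z \<partial>unif_markets K) + (1 - \<beta>) * f x"
proof -
  let ?N = "\<lambda>b. if b then unif_markets K else return (unif_markets K) x"
  have ps: "prob_space (?N b)" for b
    using x by (auto intro: prob_space_return unif.prob_space_axioms)
  have N: "?N \<in> measurable (measure_pmf (bernoulli_pmf \<beta>)) (subprob_algebra (unif_markets K))"
    using ps by (auto simp: space_subprob_algebra prob_space_imp_subprob_space unif.subprob_space_axioms
        intro!: prob_space_return prob_space_imp_subprob_space x)
  have "(\<integral>z. f z \<partial>mechanism K \<beta> x) = (\<integral>b. (\<integral>z. f z \<partial>?N b) \<partial>measure_pmf (bernoulli_pmf \<beta>))"
    unfolding mechanism_def
    using f _ N _ _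
  proof (rule integral_bind[where B' = 1])
    show "\<bar>f z\<bar> \<le> B" if "z \<in> space (unif_markets K)" for z
      using B that by simp
    show "finite_measure (measure_pmf (bernoulli_pmf \<beta>))"
      by unfold_locales
    show "AE b in measure_pmf (bernoulli_pmf \<beta>). emeasure (?N b) (space (?N b)) \<le> ennreal 1"
      using prob_space.emeasure_space_1[OF ps] by (intro AE_I2) simp
  qed
  also have "\<dots> = \<beta> * (\<integral>z. f z \<partial>unif_markets K) + (1 - \<beta>) * f x"
    using beta_range f x by (simp add: integral_return mult.commute)
  finally show ?thesis .
qed

lemma producer_utility_measurable [measurable]:
  "producer_utility K v p \<in> borel_measurable (unif_markets K)"
  unfolding producer_utility_def by measurable

lemma producer_utility_integrable: "integrable (unif_markets K) (producer_utility K v p)"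
proof (rule unif.integrable_const_bound)
  show "AE x in unif_markets K. norm (producer_utility K v p x) \<le> (\<Sum>k=1..K. \<bar>p * of_bool (p \<le> v k)\<bar>)"
    unfolding producer_utility_linear real_norm_def
    by (intro AE_I2 market_sum_bound) simp
qed measurable

text \<open>It isolates the contribution of pure noise to the posterior utility, a constant with
  respect to the observation.\<close>

definition prior_utility :: "real \<Rightarrow> real" where
  "prior_utility p = (\<integral>x. producer_utility K v p x \<partial>unif_markets K)"

lemma posterior_utility_eq:
  assumes "xh \<in> markets K"
  shows "posterior_utility K v \<beta> p xh = \<beta> * prior_utility p + (1 - \<beta>) * producer_utility K v p xh"
proof -
  \<comment> \<open>For a uniform prior the noise law and the prior agree, so the posterior after
    observing \<open>xh\<close> is the same mixture as the output law of the mechanism at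
    \<open>xh\<close>.\<close>
  have "posterior K \<beta> xh = mechanism K \<beta> xh"
    by (simp add: posterior_def mechanism_def)
  moreover have "\<bar>producer_utility K v p z\<bar> \<le> (\<Sum>k=1..K. \<bar>p * of_bool (p \<le> v k)\<bar>)" if "z \<in> markets K" for z
    unfolding producer_utility_linear using that by (rule market_sum_bound)
  ultimately show ?thesis
    unfolding posterior_utility_def prior_utility_def
    using integral_mechanism[OF producer_utility_measurable assms] by metis
qed

text \<open>Raising a price to the next value loses no sales.\<close>

lemma rounded_price:
  assumes "0 \<le> p"
  obtains j where "j \<in> {1..K}"
    "\<And>x. x \<in> markets K \<Longrightarrow> producer_utility K v p x \<le> producer_utility K v (v j) x"
proof (cases "p \<le> v K")
  case True
  \<comment> \<open>The smallest value not below \<open>p\<close>: the buyers at price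
    \<open>p\<close> and at price \<open>v j\<close> are the same.\<close>
  define j where "j = (LEAST j. j \<in> {1..K} \<and> p \<le> v j)"
  have j: "j \<in> {1..K}" "p \<le> v j"
    using LeastI[of "\<lambda>j. j \<in> {1..K} \<and> p \<le> v j" K] True K_ge_1 by (auto simp: j_def)
  have le: "j \<le> k" if "k \<in> {1..K}" "p \<le> v k" for k
    unfolding j_def using that by (intro Least_le) auto
  have iff: "p \<le> v k \<longleftrightarrow> v j \<le> v k" if "k \<in> {1..K}" for k
    using le[OF that] v_le_iff[OF j(1) that] j(2) by auto
  show ?thesis
  proof (rule that[OF j(1)])
    fix x assume x: "x \<in> markets K"
    have "producer_utility K v p x = p * (\<Sum>k=1..K. x k * of_bool (v j \<le> v k))"
      unfolding producer_utility_def using iff by (intro arg_cong2[where f = "(*)"] sum.cong) auto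
    also have "\<dots> \<le> producer_utility K v (v j) x"
      unfolding producer_utility_def using j(2) x
      by (intro mult_right_mono sum_nonneg) (auto simp: markets_def)
    finally show "producer_utility K v p x \<le> producer_utility K v (v j) x" .
  qed
next
  case False
  have "\<not> p \<le> v k" if "k \<in> {1..K}" for k
    using False v_le_iff[OF that, of K] that by auto
  then have zero: "producer_utility K v p x = 0" for x
    by (simp add: producer_utility_def)
  show ?thesis
  \<comment> \<open>A price above all values earns nothing, so any value does at least as well; the
    first one is taken.\<close>
  proof (rule that[of 1])
    show "1 \<in> {1..K}" using K_ge_1 by simp
    show "producer_utility K v p x \<le> producer_utility K v (v 1) x" if "x \<in> markets K" for x
      unfolding zero unfolding producer_utility_def using that v_1_pos
      by (intro mult_nonneg_nonneg sum_nonneg) (auto simp: markets_def)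
  qed
qed

section \<open>Optimality regions\<close>

text \<open>Optimality competes with all nonnegative prices, a region only with the values. The
  rounded price is better in every single market, so it stays better after averaging over the prior
  and hence under the posterior.\<close>

lemma optimal_price_iff_region:
  assumes "i \<in> {1..K}" "xh \<in> markets K"
  shows "optimal_price K v \<beta> xh (v i) \<longleftrightarrow> xh \<in> region i"
proof
  assume "optimal_price K v \<beta> xh (v i)"
  then show "xh \<in> region i"
    using assms(2) v_pos less_imp_le unfolding optimal_price_def optimal_region_def by blast
next
  assume xh: "xh \<in> region i"
  have "posterior_utility K v \<beta> p xh \<le> posterior_utility K v \<beta> (v i) xh" if "0 \<le> p" for p
  proof -
    obtain j where j: "j \<in> {1..K}"
      "\<And>x. x \<in> markets K \<Longrightarrow> producer_utility K v p x \<le> producer_utility K v (v j) x"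
      using rounded_price[OF \<open>0 \<le> p\<close>] by blast
    have "prior_utility p \<le> prior_utility (v j)"
      unfolding prior_utility_def
      by (intro integral_mono producer_utility_integrable) (simp add: j(2))
    then have "posterior_utility K v \<beta> p xh \<le> posterior_utility K v \<beta> (v j) xh"
      unfolding posterior_utility_eq[OF assms(2)] using beta_range j(2)[OF assms(2)]
      by (intro add_mono mult_left_mono) auto
    also have "\<dots> \<le> posterior_utility K v \<beta> (v i) xh"
      using xh j(1) by (simp add: optimal_region_def)
    finally show ?thesis .
  qed
  then show "optimal_price K v \<beta> xh (v i)"
    using v_pos[OF assms(1)] by (simp add: optimal_price_def)
qed

lemma region_exists:
  assumes "xh \<in> markets K"
  obtains i where "i \<in> {1..K}" "xh \<in> region i"
proof -
  let ?f = "\<lambda>i. posterior_utility K v \<beta> (v i) xh"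
  have "Max (?f ` {1..K}) \<in> ?f ` {1..K}"
    using K_ge_1 by (intro Max_in) auto
  then obtain i where i: "i \<in> {1..K}" "?f i = Max (?f ` {1..K})"
    by auto
  then have "xh \<in> region i"
    using assms by (auto simp: optimal_region_def)
  with i(1) show ?thesis by (rule that)
qed

lemma region_measurable [measurable]: "region i \<in> sets (unif_markets K)"
proof -
  have "region i = {x \<in> space (unif_markets K). \<forall>j\<in>{1..K}.
      \<beta> * prior_utility (v j) + (1 - \<beta>) * producer_utility K v (v j) x
        \<le> \<beta> * prior_utility (v i) + (1 - \<beta>) * producer_utility K v (v i) x}"
    by (auto simp: optimal_region_def posterior_utility_eq)
  also have "\<dots> \<in> sets (unif_markets K)"
    by (intro sets.sets_Collect_finite_All borel_measurable_le borel_measurable_add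
        borel_measurable_times borel_measurable_const producer_utility_measurable) simp
  finally show ?thesis .
qed

text \<open>On the overlap the two prices have equal posterior utility, a linear equation in the
  observation whose coefficients carry the factor \<open>1 - \<beta>\<close>. For
  \<open>\<beta> < 1\<close> it defines a proper hyperplane section; for \<open>\<beta> = 1\<close>
  it degenerates, and uniqueness of the optimal price excludes the overlap.\<close>

lemma AE_regions_disjoint:
  assumes "i \<in> {1..K}" "j \<in> {1..K}" "i < j"
  shows "AE x in unif_markets K. \<not> (x \<in> region i \<and> x \<in> region j)"
proof (cases "\<beta> = 1")
  case True
  have "\<not> (x \<in> region i \<and> x \<in> region j)" if "x \<in> markets K" for x
    using unique_optimal_price[OF True that] optimal_price_iff_region[OF assms(1) that]
      optimal_price_iff_region[OF assms(2) that] v_less_iff[OF assms(1,2)] assms(3)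
    by (metis less_irrefl)
  then show ?thesis
    by (intro AE_I2) simp
next
  case False
  \<comment> \<open>The coefficients of \<open>1 - \<beta>\<close> times the difference of the
    producer utilities at the prices \<open>v i\<close> and \<open>v j\<close>.\<close>
  define a where "a k = (1 - \<beta>) * (v i * of_bool (v i \<le> v k) - v j * of_bool (v j \<le> v k))" for k
  have K: "K \<in> {1..K}" "i \<le> K" "j \<le> K"
    using assms K_ge_1 by auto
  \<comment> \<open>A buyer of value \<open>v i\<close> accepts only the lower price, a buyer of the
    top value accepts both. Hence \<open>a i - a K = (1 - \<beta>) * v j\<close>, which is
    nonzero.\<close>
  have "a i = (1 - \<beta>) * v i"
    using v_less_iff[OF assms(1,2)] assms(3) by (simp add: a_def)
  moreover have "a K = (1 - \<beta>) * (v i - v j)"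
    using v_le_iff[OF assms(1) K(1)] v_le_iff[OF assms(2) K(1)] K(2,3) by (simp add: a_def)
  ultimately have "a i \<noteq> a K"
    using v_pos[OF assms(2)] False by simp
  then have "AE x in unif_markets K. (\<Sum>k=1..K. a k * x k) \<noteq> \<beta> * (prior_utility (v j) - prior_utility (v i))"
    by (intro AE_unif_markets_hyperplane[OF K_ge_1 assms(1)])
  then show ?thesis
  proof eventually_elim
    case (elim x)
    have "(\<Sum>k=1..K. a k * x k) = \<beta> * (prior_utility (v j) - prior_utility (v i))"
      if "x \<in> region i" "x \<in> region j"
    proof -
      have "x \<in> markets K" and "posterior_utility K v \<beta> (v i) x = posterior_utility K v \<beta> (v j) x"
        using that assms(1,2) by (auto simp: optimal_region_def intro: antisym)
      moreover have "(\<Sum>k=1..K. a k * x k)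
          = (1 - \<beta>) * (producer_utility K v (v i) x - producer_utility K v (v j) x)"
        unfolding a_def producer_utility_linear sum_distrib_left sum_subtractf[symmetric]
        by (intro sum.cong) (simp_all add: algebra_simps)
      ultimately show ?thesis
        by (simp add: posterior_utility_eq algebra_simps)
    qed
    with elim show ?case by blast
  qed
qed

text \<open>Posterior utility is affine in the observation, so its value at the mixture is the
  weighted average of its values, and every inequality that defines the region survives averaging.
  Points of weight zero may lie outside the region.\<close>

lemma region_convex:
  assumes "finite A" "A \<subseteq> markets K" "\<And>x. x \<in> A \<Longrightarrow> 0 \<le> w x" "(\<Sum>x\<in>A. w x) = 1"
    and "\<And>x. x \<in> A \<Longrightarrow> w x \<noteq> 0 \<Longrightarrow> x \<in> region i"
  shows "(\<lambda>k\<in>{1..K}. \<Sum>x\<in>A. w x * x k) \<in> region i"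
proof -
  let ?y = "\<lambda>k\<in>{1..K}. \<Sum>x\<in>A. w x * x k"
  have y: "?y \<in> markets K"
    by (rule markets_convex_combination[OF assms(1-4)])
  have avg: "posterior_utility K v \<beta> p ?y = (\<Sum>x\<in>A. w x * posterior_utility K v \<beta> p x)" for p
  proof -
    have "(\<Sum>x\<in>A. w x * posterior_utility K v \<beta> p x)
        = (\<Sum>x\<in>A. \<beta> * prior_utility p * w x + (1 - \<beta>) * (w x * producer_utility K v p x))"
      using assms(2) by (intro sum.cong) (auto simp: posterior_utility_eq subset_iff algebra_simps)
    also have "\<dots> = \<beta> * prior_utility p * (\<Sum>x\<in>A. w x) + (1 - \<beta>) * (\<Sum>x\<in>A. w x * producer_utility K v p x)"
      by (simp add: sum.distrib sum_distrib_left)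
    also have "\<dots> = posterior_utility K v \<beta> p ?y"
      unfolding posterior_utility_eq[OF y] assms(4) producer_utility_linear sum_convex_combination by simp
    finally show ?thesis ..
  qed
  have "posterior_utility K v \<beta> (v j) ?y \<le> posterior_utility K v \<beta> (v i) ?y" if "j \<in> {1..K}" for j
    unfolding avg
  proof (intro sum_mono)
    fix x assume "x \<in> A"
    then show "w x * posterior_utility K v \<beta> (v j) x \<le> w x * posterior_utility K v \<beta> (v i) x"
      using assms(3)[of x] assms(5)[of x] that
      by (cases "w x = 0") (auto simp: optimal_region_def intro!: mult_left_mono)
  qed
  with y show ?thesis
    by (simp add: optimal_region_def)
qed

section \<open>Expected utility under a pricing rule\<close>

lemma expectation_pricing_rule:
  assumes "optimal_pricing_rule K v \<beta> \<phi>" "xh \<in> markets K"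
  shows "measure_pmf.expectation (\<phi> xh) h = (\<Sum>k=1..K. pmf (\<phi> xh) (v k) * (h (v k) :: real))"
proof -
  have "measure_pmf.expectation (\<phi> xh) h = (\<Sum>p\<in>v ` {1..K}. h p * pmf (\<phi> xh) p)"
    using assms by (intro integral_measure_pmf_real) (auto simp: optimal_pricing_rule_def)
  then show ?thesis
    by (simp add: sum.reindex[OF v_inj] mult.commute)
qed

lemma sum_pricing_rule:
  assumes "optimal_pricing_rule K v \<beta> \<phi>" "xh \<in> markets K"
  shows "(\<Sum>k=1..K. pmf (\<phi> xh) (v k)) = 1"
  using expectation_pricing_rule[OF assms, of "\<lambda>_. 1"] by simp

lemma pricing_rule_region:
  assumes "optimal_pricing_rule K v \<beta> \<phi>" "xh \<in> markets K" "k \<in> {1..K}" "pmf (\<phi> xh) (v k) \<noteq> 0"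
  shows "xh \<in> region k"
  using assms optimal_price_iff_region[OF assms(3,2)]
  by (auto simp: optimal_pricing_rule_def set_pmf_iff)

text \<open>Almost every observation lies in exactly one region, so any optimal rule charges the
  same price there with probability 1, and the noisy half does not depend on the rule. The truthful
  half evaluates the rule at the single market \<open>x\<close>, where ties may remain, so the
  weights of \<open>\<phi> x\<close> stay.\<close>

lemma expected_utility_eq:
  assumes \<phi>: "optimal_pricing_rule K v \<beta> \<phi>" and x: "x \<in> markets K"
  shows "expected_utility K \<beta> u \<phi> x =
    \<beta> * (\<Sum>k=1..K. measure (unif_markets K) (region k) * u (v k) x)
    + (1 - \<beta>) * (\<Sum>k=1..K. pmf (\<phi> x) (v k) * u (v k) x)"
proof -
  let ?U = "unif_markets K"
  define f where "f xh = measure_pmf.expectation (\<phi> xh) (\<lambda>q. u q x)" for xh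
  \<comment> \<open>A measurable substitute for \<open>f\<close>, built from the regions alone; the
    rule itself may be arbitrary on overlaps.\<close>
  define g where "g xh = (\<Sum>k=1..K. indicator (region k) xh * u (v k) x)" for xh
  have f_eq: "f xh = (\<Sum>k=1..K. pmf (\<phi> xh) (v k) * u (v k) x)" if "xh \<in> markets K" for xh
    unfolding f_def by (rule expectation_pricing_rule[OF \<phi> that])
  have "AE xh in ?U. \<forall>i\<in>{1..K}. \<forall>j\<in>{1..K}. i < j \<longrightarrow> \<not> (xh \<in> region i \<and> xh \<in> region j)"
    using AE_regions_disjoint by (auto intro!: AE_finite_allI)
  then have f_AE_g: "AE xh in ?U. f xh = g xh"
    using AE_space
  proof eventually_elim
    case (elim xh)
    then have xh: "xh \<in> markets K" by simp
    obtain i where i: "i \<in> {1..K}" "xh \<in> region i"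
      using region_exists[OF xh] .
    have region_iff: "xh \<in> region k \<longleftrightarrow> k = i" if "k \<in> {1..K}" for k
      using elim(1) i that by (metis linorder_neqE_nat)
    have "pmf (\<phi> xh) (v k) = indicator (region k) xh" if "k \<in> {1..K}" for k
    proof (cases "k = i")
      case True
      \<comment> \<open>Only the region of index \<open>i\<close> contains \<open>xh\<close>, so
        \<open>v i\<close> has to absorb the total mass 1 of the price law.\<close>
      have "(\<Sum>k=1..K. pmf (\<phi> xh) (v k)) = (\<Sum>k=1..K. if k = i then pmf (\<phi> xh) (v k) else 0)"
        using pricing_rule_region[OF \<phi> xh] region_iff by (intro sum.cong) auto
      then show ?thesis
        using sum_pricing_rule[OF \<phi> xh] i True by simp
    next
      case False
      then show ?thesis
        using pricing_rule_region[OF \<phi> xh that] region_iff[OF that] by auto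
    qed
    then show "f xh = g xh"
      unfolding f_eq[OF xh] g_def by (intro sum.cong) auto
  qed
  have g: "g \<in> borel_measurable ?U"
    unfolding g_def by measurable
  then have f: "f \<in> borel_measurable ?U"
    using f_AE_g unfolding unif_markets_eq by (rule completion.borel_measurable_AE_eq)
  have bound: "\<bar>f xh\<bar> \<le> (\<Sum>k=1..K. \<bar>u (v k) x\<bar>)" if "xh \<in> markets K" for xh
  proof -
    have "\<bar>pmf (\<phi> xh) (v k) * u (v k) x\<bar> \<le> \<bar>u (v k) x\<bar>" for k
      by (simp add: abs_mult pmf_le_1 mult_left_le_one_le)
    then show ?thesis
      unfolding f_eq[OF that] by (intro order.trans[OF sum_abs] sum_mono)
  qed
  have "(\<integral>xh. f xh \<partial>?U) = (\<integral>xh. g xh \<partial>?U)"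
    using f_AE_g by (intro integral_cong_AE f g)
  also have "\<dots> = (\<Sum>k=1..K. measure ?U (region k) * u (v k) x)"
    using sets.sets_into_space[OF region_measurable] unfolding g_def
    by (subst Bochner_Integration.integral_sum) (auto simp: unif.emeasure_eq_measure Int_absorb2)
  finally show ?thesis
    using integral_mechanism[OF f x bound] f_eq[OF x] by (simp add: expected_utility_def f_def)
qed

text \<open>The region probabilities are the same for all segments. In the noisy part the average
  over \<open>\<sigma>\<close> thus passes into the linear utility and gives its value at the
  aggregated market; the truthful part is only regrouped by price.\<close>

lemma segmentation_expected_utility:
  assumes \<sigma>: "segmentation K xs \<sigma>" and \<phi>: "optimal_pricing_rule K v \<beta> \<phi>"
    and u: "\<And>p x. u p x = (\<Sum>k=1..K. x k * c p k)"
  shows "(\<Sum>x\<in>set_pmf \<sigma>. pmf \<sigma> x * expected_utility K \<beta> u \<phi> x) =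
    \<beta> * (\<Sum>k=1..K. measure (unif_markets K) (region k) * u (v k) xs)
    + (1 - \<beta>) * (\<Sum>k=1..K. \<Sum>x\<in>set_pmf \<sigma>. pmf \<sigma> x * pmf (\<phi> x) (v k) * u (v k) x)"
proof -
  let ?P = "\<lambda>k. measure (unif_markets K) (region k)"
  have mean: "(\<Sum>x\<in>set_pmf \<sigma>. pmf \<sigma> x * u p x) = u p xs" for p
  proof -
    have "(\<Sum>x\<in>set_pmf \<sigma>. pmf \<sigma> x * u p x) = (\<Sum>k=1..K. (\<Sum>x\<in>set_pmf \<sigma>. pmf \<sigma> x * x k) * c p k)"
      unfolding u sum_distrib_left sum_distrib_right by (subst sum.swap) (simp add: mult.assoc)
    also have "\<dots> = u p xs"
      using \<sigma> by (simp add: u segmentation_def)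
    finally show ?thesis .
  qed
  have "(\<Sum>x\<in>set_pmf \<sigma>. pmf \<sigma> x * expected_utility K \<beta> u \<phi> x) =
    (\<Sum>x\<in>set_pmf \<sigma>. \<beta> * (\<Sum>k=1..K. ?P k * (pmf \<sigma> x * u (v k) x))
      + (1 - \<beta>) * (\<Sum>k=1..K. pmf \<sigma> x * pmf (\<phi> x) (v k) * u (v k) x))"
  proof (intro sum.cong refl)
    fix x assume "x \<in> set_pmf \<sigma>"
    with \<sigma> have "x \<in> markets K"
      by (auto simp: segmentation_def)
    then show "pmf \<sigma> x * expected_utility K \<beta> u \<phi> x =
      \<beta> * (\<Sum>k=1..K. ?P k * (pmf \<sigma> x * u (v k) x))
      + (1 - \<beta>) * (\<Sum>k=1..K. pmf \<sigma> x * pmf (\<phi> x) (v k) * u (v k) x)"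
      by (simp add: expected_utility_eq[OF \<phi>] sum_distrib_left algebra_simps)
  qed
  also have "\<dots> = \<beta> * (\<Sum>x\<in>set_pmf \<sigma>. \<Sum>k=1..K. ?P k * (pmf \<sigma> x * u (v k) x))
      + (1 - \<beta>) * (\<Sum>x\<in>set_pmf \<sigma>. \<Sum>k=1..K. pmf \<sigma> x * pmf (\<phi> x) (v k) * u (v k) x)"
    by (simp add: sum.distrib sum_distrib_left)
  also have "(\<Sum>x\<in>set_pmf \<sigma>. \<Sum>k=1..K. ?P k * (pmf \<sigma> x * u (v k) x)) = (\<Sum>k=1..K. ?P k * u (v k) xs)"
    by (subst sum.swap) (simp add: mean flip: sum_distrib_left)
  also have "(\<Sum>x\<in>set_pmf \<sigma>. \<Sum>k=1..K. pmf \<sigma> x * pmf (\<phi> x) (v k) * u (v k) x)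
      = (\<Sum>k=1..K. \<Sum>x\<in>set_pmf \<sigma>. pmf \<sigma> x * pmf (\<phi> x) (v k) * u (v k) x)"
    by (rule sum.swap)
  finally show ?thesis .
qed

section \<open>Merging segments and splitting weights\<close>

text \<open>All segments charged \<open>v k\<close> are merged into their conditional mean, which
  convexity keeps in the region of \<open>v k\<close>. The last clause ranges over all linear
  utilities so that one choice of \<open>\<gamma>\<close> and \<open>y\<close> serves consumer and
  producer alike.\<close>

lemma segmentation_to_truthful:
  assumes \<sigma>: "segmentation K xs \<sigma>" and \<phi>: "optimal_pricing_rule K v \<beta> \<phi>"
  obtains \<gamma> y where
    "\<And>k. k \<in> {1..K} \<Longrightarrow> \<gamma> k \<in> {0..1::real}"
    "\<And>k. k \<in> {1..K} \<Longrightarrow> \<gamma> k \<noteq> 0 \<Longrightarrow> y k \<in> region k"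
    "\<And>j. j \<in> {1..K} \<Longrightarrow> (\<Sum>k=1..K. \<gamma> k * y k j) = xs j"
    "(\<Sum>k=1..K. \<gamma> k) = 1"
    "\<And>u c k. (\<And>p x. u p x = (\<Sum>j=1..K. x j * c p j)) \<Longrightarrow> k \<in> {1..K} \<Longrightarrow>
      (\<Sum>x\<in>set_pmf \<sigma>. pmf \<sigma> x * pmf (\<phi> x) (v k) * u (v k) x) = \<gamma> k * u (v k) (y k)"
proof -
  let ?S = "set_pmf \<sigma>"
  have fin: "finite ?S" and S: "?S \<subseteq> markets K"
    and mean: "\<And>j. j \<in> {1..K} \<Longrightarrow> (\<Sum>x\<in>?S. pmf \<sigma> x * x j) = xs j"
    using \<sigma> by (auto simp: segmentation_def)
  \<comment> \<open>\<open>a k x\<close> is the joint probability of segment \<open>x\<close> and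
    price \<open>v k\<close>, \<open>\<gamma> k\<close> the marginal probability of the price, and
    \<open>y k\<close> the mean market given that price.\<close>
  define a where "a k x = pmf \<sigma> x * pmf (\<phi> x) (v k)" for k x
  define \<gamma> where "\<gamma> k = (\<Sum>x\<in>?S. a k x)" for k
  define y where "y k = (\<lambda>j\<in>{1..K}. \<Sum>x\<in>?S. a k x / \<gamma> k * x j)" for k
  have a_nonneg: "0 \<le> a k x" for k x
    by (simp add: a_def)
  have \<gamma>_nonneg: "0 \<le> \<gamma> k" for k
    unfolding \<gamma>_def by (intro sum_nonneg a_nonneg)
  have a_sum: "(\<Sum>k=1..K. a k x) = pmf \<sigma> x" if "x \<in> ?S" for x
    using sum_pricing_rule[OF \<phi>, of x] S that unfolding a_def by (auto simp flip: sum_distrib_left)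
  \<comment> \<open>If \<open>\<gamma> k = 0\<close>, then all the nonnegative summands
    \<open>a k x\<close> vanish, so the identity holds in spite of the division by zero.\<close>
  have a_eq: "a k x = \<gamma> k * (a k x / \<gamma> k)" if "x \<in> ?S" for k x
  proof (cases "\<gamma> k = 0")
    case True
    then have "a k x = 0"
      using fin a_nonneg that by (simp add: \<gamma>_def sum_nonneg_eq_0_iff)
    then show ?thesis by simp
  qed simp
  have \<gamma>_sum: "(\<Sum>k=1..K. \<gamma> k) = 1"
    unfolding \<gamma>_def using a_sum fin by (subst sum.swap) (simp add: sum_pmf_eq_1)
  show ?thesis
  proof (rule that[of \<gamma> y])
    fix k assume k: "k \<in> {1..K}"
    then have "\<gamma> k \<le> (\<Sum>k=1..K. \<gamma> k)"
      by (intro member_le_sum \<gamma>_nonneg) auto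
    then show "\<gamma> k \<in> {0..1}"
      using \<gamma>_nonneg \<gamma>_sum by simp
    show "y k \<in> region k" if "\<gamma> k \<noteq> 0"
      unfolding y_def
    proof (rule region_convex[OF fin S])
      show "(\<Sum>x\<in>?S. a k x / \<gamma> k) = 1"
        using that by (simp add: \<gamma>_def flip: sum_divide_distrib)
      show "x \<in> region k" if "x \<in> ?S" "a k x / \<gamma> k \<noteq> 0" for x
        using that S k pricing_rule_region[OF \<phi>, of x k] by (auto simp: a_def)
    qed (simp add: a_nonneg \<gamma>_nonneg)
    show "(\<Sum>x\<in>?S. pmf \<sigma> x * pmf (\<phi> x) (v k) * u (v k) x) = \<gamma> k * u (v k) (y k)"
      if "\<And>p x. u p x = (\<Sum>j=1..K. x j * c p j)" for u c
    proof -
      have "(\<Sum>x\<in>?S. pmf \<sigma> x * pmf (\<phi> x) (v k) * u (v k) x) = (\<Sum>x\<in>?S. \<gamma> k * (a k x / \<gamma> k * u (v k) x))"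
      proof (intro sum.cong refl)
        fix x assume "x \<in> ?S"
        from a_eq[OF this, of k] show "pmf \<sigma> x * pmf (\<phi> x) (v k) * u (v k) x = \<gamma> k * (a k x / \<gamma> k * u (v k) x)"
          unfolding a_def by (metis mult.assoc)
      qed
      also have "\<dots> = \<gamma> k * u (v k) (y k)"
        unfolding y_def that sum_convex_combination by (simp add: sum_distrib_left)
      finally show ?thesis .
    qed
  next
    fix j assume j: "j \<in> {1..K}"
    have "(\<Sum>k=1..K. \<gamma> k * y k j) = (\<Sum>k=1..K. \<Sum>x\<in>?S. \<gamma> k * (a k x / \<gamma> k) * x j)"
      using j by (simp only: y_def restrict_apply' sum_distrib_left mult.assoc)
    also have "\<dots> = (\<Sum>x\<in>?S. (\<Sum>k=1..K. a k x) * x j)"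
      unfolding sum_distrib_right by (subst sum.swap) (intro sum.cong refl, simp only: a_eq[symmetric])
    also have "\<dots> = xs j"
      using a_sum mean[OF j] by simp
    finally show "(\<Sum>k=1..K. \<gamma> k * y k j) = xs j" .
  qed (rule \<gamma>_sum)
qed

text \<open>Draw a price index with law \<open>\<gamma>\<close>: its market has law \<open>\<sigma>\<close>, and \<open>\<phi>\<close> is the conditional law
  of the price given the market. Conditioning is needed since the \<open>y k\<close> need not be distinct.\<close>

lemma truthful_to_segmentation:
  assumes \<gamma>: "\<And>k. k \<in> {1..K} \<Longrightarrow> 0 \<le> \<gamma> k" "(\<Sum>k=1..K. \<gamma> k) = (1::real)"
    and y: "\<And>k. k \<in> {1..K} \<Longrightarrow> \<gamma> k \<noteq> 0 \<Longrightarrow> y k \<in> region k"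
    and mean: "\<And>j. j \<in> {1..K} \<Longrightarrow> (\<Sum>k=1..K. \<gamma> k * y k j) = xs j"
  obtains \<sigma> \<phi> where "segmentation K xs \<sigma>" "optimal_pricing_rule K v \<beta> \<phi>"
    "\<And>(u :: real \<Rightarrow> market \<Rightarrow> real) k. k \<in> {1..K} \<Longrightarrow>
      (\<Sum>x\<in>set_pmf \<sigma>. pmf \<sigma> x * pmf (\<phi> x) (v k) * u (v k) x) = \<gamma> k * u (v k) (y k)"
proof -
  obtain p where p: "set_pmf p \<subseteq> {1..K}" "\<And>k. k \<in> {1..K} \<Longrightarrow> pmf p k = \<gamma> k"
    using pmf_of_weights[of "{1..K}" \<gamma>] \<gamma> by auto
  have y_region: "y k \<in> region k" if "k \<in> set_pmf p" for k
    using y[of k] p that by (auto simp: set_pmf_iff)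
  have fin: "finite (set_pmf p)"
    using p(1) finite_subset by blast
  define \<sigma> where "\<sigma> = map_pmf y p"
  \<comment> \<open>Off the support of \<open>\<sigma>\<close> there is nothing to condition on, and
    some value whose region contains \<open>x\<close> is picked to keep the rule optimal.\<close>
  define \<phi> where "\<phi> x = (if x \<in> set_pmf \<sigma> then map_pmf v (cond_pmf p (y -` {x}))
      else return_pmf (v (SOME i. i \<in> {1..K} \<and> x \<in> region i)))" for x
  have "set_pmf (\<phi> xh) \<subseteq> v ` {i\<in>{1..K}. xh \<in> region i}" if "xh \<in> markets K" for xh
  proof (cases "xh \<in> set_pmf \<sigma>")
    case True
    then have "set_pmf p \<inter> y -` {xh} \<noteq> {}"
      by (auto simp: \<sigma>_def)
    then have "set_pmf (\<phi> xh) = v ` (set_pmf p \<inter> y -` {xh})"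
      using True by (simp add: \<phi>_def)
    then show ?thesis
      using y_region p(1) by auto
  next
    case False
    have "\<exists>i. i \<in> {1..K} \<and> xh \<in> region i"
      using region_exists[OF that] by blast
    from someI_ex[OF this] False show ?thesis
      by (auto simp: \<phi>_def)
  qed
  then have \<phi>: "optimal_pricing_rule K v \<beta> \<phi>"
    unfolding optimal_pricing_rule_def using optimal_price_iff_region by blast
  have "(\<Sum>x\<in>set_pmf \<sigma>. pmf \<sigma> x * x j) = xs j" if "j \<in> {1..K}" for j
  proof -
    have "(\<Sum>x\<in>set_pmf \<sigma>. pmf \<sigma> x * x j) = measure_pmf.expectation \<sigma> (\<lambda>x. x j)"
      using fin by (subst integral_measure_pmf_real[where A = "set_pmf \<sigma>"]) (auto simp: \<sigma>_def mult.commute)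
    also have "\<dots> = measure_pmf.expectation p (\<lambda>k. y k j)"
      by (simp add: \<sigma>_def)
    also have "\<dots> = (\<Sum>k=1..K. \<gamma> k * y k j)"
      using p by (subst integral_measure_pmf_real[where A = "{1..K}"]) (auto simp: mult.commute intro!: sum.cong)
    finally show ?thesis
      using mean[OF that] by simp
  qed
  then have \<sigma>: "segmentation K xs \<sigma>"
    using fin y_region by (auto simp: segmentation_def \<sigma>_def optimal_region_def)
  \<comment> \<open>The product of marginal and conditional probability is the joint one: index
    \<open>k\<close> is drawn and its market is \<open>x\<close>. Injectivity of \<open>v\<close>
    identifies a price with its index.\<close>
  have joint: "pmf \<sigma> x * pmf (\<phi> x) (v k) = (if x = y k then \<gamma> k else 0)"
    if "x \<in> set_pmf \<sigma>" "k \<in> {1..K}" for x k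
  proof -
    let ?q = "cond_pmf p (y -` {x})"
    have ne: "set_pmf p \<inter> y -` {x} \<noteq> {}"
      using that(1) by (auto simp: \<sigma>_def)
    then have set_q: "set_pmf ?q \<subseteq> {1..K}"
      using p(1) by auto
    have "pmf (\<phi> x) (v k) = pmf ?q k"
    proof (cases "k \<in> set_pmf ?q")
      case True
      then show ?thesis
        using that(1) inj_on_subset[OF v_inj set_q] by (simp add: \<phi>_def pmf_map_inj)
    next
      case False
      then have "v k \<notin> v ` set_pmf ?q"
        using inj_on_image_mem_iff[OF v_inj that(2) set_q] by simp
      then show ?thesis
        using that(1) False by (simp add: \<phi>_def pmf_map_outside pmf_eq_0_set_pmf)
    qed
    moreover have "pmf \<sigma> x = measure p (y -` {x})"
      by (simp add: \<sigma>_def pmf_map)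
    moreover have "pmf \<sigma> x \<noteq> 0"
      using that(1) by (simp add: set_pmf_iff)
    ultimately show ?thesis
      using p(2)[OF that(2)] by (auto simp: pmf_cond[OF ne])
  qed
  show ?thesis
  proof (rule that[OF \<sigma> \<phi>])
    fix u :: "real \<Rightarrow> market \<Rightarrow> real" and k assume k: "k \<in> {1..K}"
    have "(\<Sum>x\<in>set_pmf \<sigma>. pmf \<sigma> x * pmf (\<phi> x) (v k) * u (v k) x)
        = (\<Sum>x\<in>set_pmf \<sigma>. if x = y k then \<gamma> k * u (v k) x else 0)"
      using joint k by (intro sum.cong) auto
    also have "\<dots> = (if y k \<in> set_pmf \<sigma> then \<gamma> k * u (v k) (y k) else 0)"
      using fin by (subst sum.delta) (auto simp: \<sigma>_def)
    \<comment> \<open>If \<open>y k\<close> is outside the support of \<open>\<sigma>\<close>, the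
      index \<open>k\<close> is never drawn, so \<open>\<gamma> k = 0\<close>.\<close>
    also have "\<dots> = \<gamma> k * u (v k) (y k)"
      using p(2)[OF k] by (auto simp: \<sigma>_def set_pmf_iff)
    finally show "(\<Sum>x\<in>set_pmf \<sigma>. pmf \<sigma> x * pmf (\<phi> x) (v k) * u (v k) x) = \<gamma> k * u (v k) (y k)" .
  qed
qed

section \<open>The decomposition of the achievable set\<close>

lemma achievable_eq:
  "achievable K v \<beta> xs =
    {\<beta> *\<^sub>R noise_utility K v \<beta> xs + (1 - \<beta>) *\<^sub>R s | s. s \<in> truthful_achievable K v \<beta> xs}"
    (is "_ = ?R")
proof (intro equalityI subsetI)
  fix z assume "z \<in> achievable K v \<beta> xs"
  then obtain \<sigma> \<phi> where \<sigma>: "segmentation K xs \<sigma>" and \<phi>: "optimal_pricing_rule K v \<beta> \<phi>"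
    and z: "z = (\<Sum>x\<in>set_pmf \<sigma>. pmf \<sigma> x * expected_utility K \<beta> (consumer_utility K v) \<phi> x,
      \<Sum>x\<in>set_pmf \<sigma>. pmf \<sigma> x * expected_utility K \<beta> (producer_utility K v) \<phi> x)"
    unfolding achievable_def by blast
  obtain \<gamma> y where *:
    "\<And>k. k \<in> {1..K} \<Longrightarrow> \<gamma> k \<in> {0..1::real}"
    "\<And>k. k \<in> {1..K} \<Longrightarrow> \<gamma> k \<noteq> 0 \<Longrightarrow> y k \<in> region k"
    "\<And>j. j \<in> {1..K} \<Longrightarrow> (\<Sum>k=1..K. \<gamma> k * y k j) = xs j"
    "(\<Sum>k=1..K. \<gamma> k) = 1"
    "\<And>u c k. (\<And>p x. u p x = (\<Sum>j=1..K. x j * c p j)) \<Longrightarrow> k \<in> {1..K} \<Longrightarrow>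
      (\<Sum>x\<in>set_pmf \<sigma>. pmf \<sigma> x * pmf (\<phi> x) (v k) * u (v k) x) = \<gamma> k * u (v k) (y k)"
    using segmentation_to_truthful[OF \<sigma> \<phi>] by blast
  let ?s = "(\<Sum>k=1..K. \<gamma> k * consumer_utility K v (v k) (y k),
       \<Sum>k=1..K. \<gamma> k * producer_utility K v (v k) (y k))"
  have "?s \<in> truthful_achievable K v \<beta> xs"
    unfolding truthful_achievable_def using *(1-4) by blast
  moreover have "z = \<beta> *\<^sub>R noise_utility K v \<beta> xs + (1 - \<beta>) *\<^sub>R ?s"
    unfolding z segmentation_expected_utility[OF \<sigma> \<phi> consumer_utility_linear]
      segmentation_expected_utility[OF \<sigma> \<phi> producer_utility_linear]
    by (simp add: noise_utility_def *(5)[of "consumer_utility K v", OF consumer_utility_linear]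
        *(5)[of "producer_utility K v", OF producer_utility_linear])
  ultimately show "z \<in> ?R"
    by blast
next
  fix z assume "z \<in> ?R"
  then obtain \<gamma> y where weights:
      "\<forall>k\<in>{1..K}. \<gamma> k \<in> {0..1} \<and> (\<gamma> k \<noteq> 0 \<longrightarrow> y k \<in> region k)"
      "\<forall>j\<in>{1..K}. (\<Sum>k=1..K. \<gamma> k * y k j) = xs j" "(\<Sum>k=1..K. \<gamma> k) = 1"
    and z: "z = \<beta> *\<^sub>R noise_utility K v \<beta> xs + (1 - \<beta>) *\<^sub>R
      (\<Sum>k=1..K. \<gamma> k * consumer_utility K v (v k) (y k),
       \<Sum>k=1..K. \<gamma> k * producer_utility K v (v k) (y k))"
    unfolding truthful_achievable_def by blast
  obtain \<sigma> \<phi> where \<sigma>: "segmentation K xs \<sigma>" and \<phi>: "optimal_pricing_rule K v \<beta> \<phi>"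
    and eq: "\<And>(u :: real \<Rightarrow> market \<Rightarrow> real) k. k \<in> {1..K} \<Longrightarrow>
      (\<Sum>x\<in>set_pmf \<sigma>. pmf \<sigma> x * pmf (\<phi> x) (v k) * u (v k) x) = \<gamma> k * u (v k) (y k)"
    using truthful_to_segmentation[of \<gamma> y xs] weights by auto
  have "z = (\<Sum>x\<in>set_pmf \<sigma>. pmf \<sigma> x * expected_utility K \<beta> (consumer_utility K v) \<phi> x,
      \<Sum>x\<in>set_pmf \<sigma>. pmf \<sigma> x * expected_utility K \<beta> (producer_utility K v) \<phi> x)"
    unfolding z segmentation_expected_utility[OF \<sigma> \<phi> consumer_utility_linear]
      segmentation_expected_utility[OF \<sigma> \<phi> producer_utility_linear]
    by (simp add: noise_utility_def eq)
  with \<sigma> \<phi> show "z \<in> achievable K v \<beta> xs"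
    unfolding achievable_def by blast
qed

end

theorem proposition4:
  fixes K :: nat and v :: "nat \<Rightarrow> real" and xs :: market and \<beta> :: real
  assumes "2 \<le> K"
    and "0 < v 1" and "strict_mono_on {1..K} v"
    and "xs \<in> markets K"
    and "0 \<le> \<beta>" and "\<beta> \<le> 1"
    and "\<beta> = 1 \<Longrightarrow> \<forall>xh\<in>markets K. \<exists>!p. optimal_price K v \<beta> xh p"
  shows "achievable K v \<beta> xs =
    {\<beta> *\<^sub>R noise_utility K v \<beta> xs + (1 - \<beta>) *\<^sub>R s | s. s \<in> truthful_achievable K v \<beta> xs}"
proof -
  interpret privacy_model K v \<beta>
    using assms by unfold_locales auto
  show ?thesis
    by (rule achievable_eq)
qed

end
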